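(* Let $N\in\mathbb{I}_{\ge 1}$, $\epsilon_{\mathrm{o}}\in(0,1)$, $\eta:=1-\epsilon_{\mathrm{o}}$, and let $\overline\gamma\ge0$, $\gamma_k\in[0,\overline\gamma]$, $k\in\mathbb{I}_{\ge1}$, be constants. Let $\underline{\gamma}_{\mathrm{o}}=\overline{\gamma}_{\mathrm{o}}=1$, and let $\alpha_N$ be defined by the linear program $$\epsilon_{\mathrm{o}}(\alpha_N-1)=\min_{\tilde\ell,\tilde W,\tilde\sigma,\tilde V}\ \sum_{k=1}^{N-1}\tilde\ell_k-\tilde V$$ over real variables $\tilde\ell_k$ ($k\in\mathbb{I}_{[0,N-1]}$), $\tilde W_k,\tilde\sigma_k$ ($k\in\mathbb{I}_{[0,N]}$), $\tilde V$, subject to \begin{align*} &\tilde\sigma_0=1,\\ &\tilde\ell_k\ge0,\ k\in\mathbb{I}_{[0,N-1]},\qquad \tilde\sigma_k\ge0,\ \tilde W_k\ge0,\ k\in\mathbb{I}_{[0,N]},\\ &\underline{\gamma}_{\mathrm{o}}\tilde\sigma_k\le\tilde W_k\le\overline{\gamma}_{\mathrm{o}}\tilde\sigma_k,\ k\in\mathbb{I}_{[0,N]},\\ &\tilde W_{k+1}-\tilde W_k\le-\epsilon_{\mathrm{o}}\tilde\sigma_k+\tilde\ell_k,\ k\in\mathbb{I}_{[0,N-1]},\\ &\textstyle\sum_{j=k}^{N-1}\tilde\ell_j\le\gamma_{N-k}\tilde\sigma_k,\ k\in\mathbb{I}_{[0,N-1]},\\ &\textstyle\tilde V\le\sum_{j=1}^{k-1}\tilde\ell_j+\gamma_{N-k+1}\tilde\sigma_k,\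 k\in\mathbb{I}_{[1,N]}. \end{align*} Define $\hat\alpha_N$ by $$\epsilon_{\mathrm{o}}(1-\hat\alpha_N):=\frac{\gamma_1(\gamma_N+\eta)\prod_{j=0}^{N-2}(\eta+\gamma_{N-j})}{\prod_{j=0}^{N-1}(1+\gamma_{N-j})-\gamma_1\prod_{j=0}^{N-2}(\eta+\gamma_{N-j})}.$$ Then: (i) $\epsilon_{\mathrm{o}}(1-\alpha_N)\le\epsilon_{\mathrm{o}}(1-\hat\alpha_N)$; (ii) $\alpha_N>0$ holds if $$N>\underline N:=1+\frac{\log(\overline\gamma)-\log(\epsilon_{\mathrm{o}})}{\log(1+\overline\gamma)-\log(\overline\gamma+\eta)};$$ (iii) if additionally $\gamma_k=\overline\gamma$ for all $k\in\mathbb{I}_{\ge1}$, then $\alpha_N=\hat\alpha_N$.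
   Context: $\mathbb{I}_{[a,b]}$ (resp. $\mathbb{I}_{\ge a}$) denotes the integers in $[a,b]$ (resp. $\ge a$). Empty sums are $0$ and empty products are $1$. *)

theory Defs
  imports "HOL-Analysis.Analysis"
begin

text \<open>
  The decision variables are modelled as functions on \<^typ>\<open>nat\<close>; only the values at the indices
  occurring below are constrained, and the objective depends on no other values.
\<close>

definition lp_feasible ::
  "nat \<Rightarrow> real \<Rightarrow> real \<Rightarrow> real \<Rightarrow> (nat \<Rightarrow> real) \<Rightarrow>
   (nat \<Rightarrow> real) \<Rightarrow> (nat \<Rightarrow> real) \<Rightarrow> (nat \<Rightarrow> real) \<Rightarrow> real \<Rightarrow> bool" where
  "lp_feasible N \<epsilon> \<gamma>lo \<gamma>hi \<gamma> l W \<sigma> V \<longleftrightarrow>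
     \<sigma> 0 = 1 \<and>
     (\<forall>k\<in>{0..<N}. l k \<ge> 0) \<and>
     (\<forall>k\<in>{0..N}. \<sigma> k \<ge> 0 \<and> W k \<ge> 0) \<and>
     (\<forall>k\<in>{0..N}. \<gamma>lo * \<sigma> k \<le> W k \<and> W k \<le> \<gamma>hi * \<sigma> k) \<and>
     (\<forall>k\<in>{0..<N}. W (k + 1) - W k \<le> - \<epsilon> * \<sigma> k + l k) \<and>
     (\<forall>k\<in>{0..<N}. (\<Sum>j=k..<N. l j) \<le> \<gamma> (N - k) * \<sigma> k) \<and>
     (\<forall>k\<in>{1..N}. V \<le> (\<Sum>j=1..<k. l j) + \<gamma> (N - k + 1) * \<sigma> k)"

definition lp_objective :: "nat \<Rightarrow> (nat \<Rightarrow> real) \<Rightarrow> real \<Rightarrow> real" where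
  "lp_objective N l V = (\<Sum>k=1..<N. l k) - V"

definition lp_values :: "nat \<Rightarrow> real \<Rightarrow> real \<Rightarrow> real \<Rightarrow> (nat \<Rightarrow> real) \<Rightarrow> real set" where
  "lp_values N \<epsilon> \<gamma>lo \<gamma>hi \<gamma> =
     {lp_objective N l V | l W \<sigma> V. lp_feasible N \<epsilon> \<gamma>lo \<gamma>hi \<gamma> l W \<sigma> V}"

text \<open>
  The infimum is a minimum; see \<open>lp_alpha_minimum\<close> below.
\<close>

definition lp_alpha :: "nat \<Rightarrow> real \<Rightarrow> real \<Rightarrow> real \<Rightarrow> (nat \<Rightarrow> real) \<Rightarrow> real" where
  "lp_alpha N \<epsilon> \<gamma>lo \<gamma>hi \<gamma> = 1 + Inf (lp_values N \<epsilon> \<gamma>lo \<gamma>hi \<gamma>) / \<epsilon>"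

text \<open>
  The products over \<open>j = 0, \<dots>, N - 2\<close> are written over \<open>{0..<N - 1}\<close>, which is empty for \<open>N = 1\<close>.
\<close>

definition alpha_hat :: "nat \<Rightarrow> real \<Rightarrow> (nat \<Rightarrow> real) \<Rightarrow> real" where
  "alpha_hat N \<epsilon> \<gamma> =
     (let \<eta> = 1 - \<epsilon> in
      1 - (\<gamma> 1 * (\<gamma> N + \<eta>) * (\<Prod>j=0..<N - 1. \<eta> + \<gamma> (N - j)) /
           ((\<Prod>j=0..<N. 1 + \<gamma> (N - j)) - \<gamma> 1 * (\<Prod>j=0..<N - 1. \<eta> + \<gamma> (N - j)))) / \<epsilon>)"

text \<open>
  For \<open>\<gamma>bar = 0\<close> the threshold is read with \<open>log 0 = -\<infinity>\<close>, whereas \<^term>\<open>ln (0::real)\<close> is \<open>0\<close>.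
\<close>

definition N_lower :: "real \<Rightarrow> real \<Rightarrow> ereal" where
  "N_lower \<epsilon> \<gamma>bar =
     (let \<eta> = 1 - \<epsilon> in
      if \<gamma>bar = 0 then - \<infinity>
      else ereal (1 + (ln \<gamma>bar - ln \<epsilon>) / (ln (1 + \<gamma>bar) - ln (\<gamma>bar + \<eta>))))"

lemma lp_alpha_minimum:
  assumes N: "N \<ge> 1" and eps: "0 < \<epsilon>" "\<epsilon> < 1" and g: "\<And>k. k \<ge> 1 \<Longrightarrow> 0 \<le> \<gamma> k"
  shows "\<epsilon> * (lp_alpha N \<epsilon> 1 1 \<gamma> - 1) \<in> lp_values N \<epsilon> 1 1 \<gamma>" (is ?mem)
    and "\<forall>v \<in> lp_values N \<epsilon> 1 1 \<gamma>. \<epsilon> * (lp_alpha N \<epsilon> 1 1 \<gamma> - 1) \<le> v" (is ?low)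
proof -
  define S where "S = lp_values N \<epsilon> 1 1 \<gamma>"
  define C where "C = (1 + \<gamma> N) * (1 + \<gamma> N)"
  have gN: "\<gamma> N \<ge> 0" using g N by simp
  have C1: "1 + \<gamma> N \<le> C" and C2: "\<gamma> N * (1 + \<gamma> N) \<le> C" and C3: "\<gamma> N \<le> C" and C0: "0 \<le> C"
    using gN by (auto simp: C_def algebra_simps)
  define B where "B = PiE UNIV (\<lambda>_::nat. {0..C})"
  define F where "F = {p :: (nat \<Rightarrow> real) \<times> (nat \<Rightarrow> real) \<times> real.
     lp_feasible N \<epsilon> 1 1 \<gamma> (fst p) (fst (snd p)) (fst (snd p)) (snd (snd p))}"
  define K where "K = F \<inter> (B \<times> B \<times> {0..C})"
  define obj where "obj = (\<lambda>p :: (nat \<Rightarrow> real) \<times> (nat \<Rightarrow> real) \<times> real.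
     lp_objective N (fst p) (snd (snd p)))"
  have "compact B"
    using compactin_PiE[of "\<lambda>_. euclidean :: real topology" "UNIV :: nat set" "\<lambda>_. {0..C}"]
    by (simp add: B_def euclidean_product_topology)
  then have cB: "compact (B \<times> B \<times> {0..C})"
    by (intro compact_Times) auto
  have coord1: "continuous_on UNIV (\<lambda>p :: (nat \<Rightarrow> real) \<times> (nat \<Rightarrow> real) \<times> real. fst p k)" for k
    by (rule continuous_on_compose2[OF continuous_on_product_coordinates[where i=k]])
       (intro continuous_intros, auto)
  have coord2: "continuous_on UNIV (\<lambda>p :: (nat \<Rightarrow> real) \<times> (nat \<Rightarrow> real) \<times> real. fst (snd p) k)" for k
    by (rule continuous_on_compose2[OF continuous_on_product_coordinates[where i=k]])
       (intro continuous_intros, auto)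
  have "closed F"
    unfolding F_def lp_feasible_def Ball_def
    by (intro closed_Collect_conj closed_Collect_all closed_Collect_imp open_Collect_const
          closed_Collect_le closed_Collect_eq continuous_intros coord1 coord2)
  then have cK: "compact K"
    unfolding K_def using cB by (rule closed_Int_compact)
  have cobj: "continuous_on K obj"
    unfolding obj_def lp_objective_def
    by (rule continuous_on_subset[of UNIV]) (intro continuous_intros coord1, auto)
  have reduce: "\<exists>p\<in>K. obj p \<le> lp_objective N l V"
    if f: "lp_feasible N \<epsilon> 1 1 \<gamma> l W \<sigma> V" for l W \<sigma> V
  proof -
    have s0: "\<sigma> 0 = 1" and l0: "\<And>k. k < N \<Longrightarrow> 0 \<le> l k"
      and sp: "\<And>k. k \<le> N \<Longrightarrow> 0 \<le> \<sigma> k" and W: "\<And>k. k \<le> N \<Longrightarrow> W k = \<sigma> k"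
      and dyn: "\<And>k. k < N \<Longrightarrow> W (k + 1) - W k \<le> - \<epsilon> * \<sigma> k + l k"
      and ls: "\<And>k. k < N \<Longrightarrow> (\<Sum>j=k..<N. l j) \<le> \<gamma> (N - k) * \<sigma> k"
      and Vs: "\<And>k. 1 \<le> k \<Longrightarrow> k \<le> N \<Longrightarrow> V \<le> (\<Sum>j=1..<k. l j) + \<gamma> (N - k + 1) * \<sigma> k"
      using f by (auto simp: lp_feasible_def intro!: antisym)
    have dyn': "\<sigma> (k + 1) - \<sigma> k \<le> - \<epsilon> * \<sigma> k + l k" if "k < N" for k
      using dyn[OF that] W[of k] W[of "k + 1"] that by simp
    have tot: "(\<Sum>j=0..<N. l j) \<le> \<gamma> N" using ls[of 0] N s0 by simp
    have lb: "l k \<le> \<gamma> N" if "k < N" for k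
      using member_le_sum[of k "{0..<N}" l] that l0 tot by auto
    have sb: "k \<le> N \<Longrightarrow> \<sigma> k \<le> 1 + (\<Sum>j=0..<k. l j)" for k
    proof (induction k)
      case (Suc k)
      have "0 \<le> \<epsilon> * \<sigma> k" using eps sp[of k] Suc.prems by simp
      then show ?case using Suc dyn'[of k] by simp
    qed (simp add: s0)
    have sb': "\<sigma> k \<le> 1 + \<gamma> N" if "k \<le> N" for k
    proof -
      have "(\<Sum>j=0..<k. l j) \<le> (\<Sum>j=0..<N. l j)"
        using that l0 by (intro sum_mono2) auto
      then show ?thesis using sb[OF that] tot by simp
    qed
    have "\<gamma> N * \<sigma> 1 \<le> \<gamma> N * (1 + \<gamma> N)"
      using sb'[of 1] N gN by (intro mult_left_mono) auto
    then have Vb: "V \<le> C" using Vs[of 1] N C2 by simp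
    define l' where "l' = (\<lambda>k. if k < N then l k else 0)"
    define s' where "s' = (\<lambda>k. if k \<le> N then \<sigma> k else 0)"
    define V' where "V' = max V 0"
    have suml: "(\<Sum>j=a..<b. l' j) = (\<Sum>j=a..<b. l j)" if "b \<le> N" for a b
      using that by (intro sum.cong) (auto simp: l'_def)
    have nonneg: "0 \<le> (\<Sum>j=1..<k. l j) + \<gamma> (N - k + 1) * \<sigma> k" if "1 \<le> k" "k \<le> N" for k
      using that l0 sp[of k] g[of "N - k + 1"] by (intro add_nonneg_nonneg sum_nonneg mult_nonneg_nonneg) auto
    have "lp_feasible N \<epsilon> 1 1 \<gamma> l' s' s' V'"
      unfolding lp_feasible_def
      using s0 l0 sp dyn' ls Vs nonneg by (auto simp: suml) (auto simp: l'_def s'_def V'_def)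
    moreover have "l' \<in> B" "s' \<in> B"
      using l0 sp C0 order_trans[OF lb C3] order_trans[OF sb' C1]
      by (auto simp: B_def l'_def s'_def PiE_iff)
    moreover have "V' \<in> {0..C}" using Vb C0 by (auto simp: V'_def)
    ultimately have "(l', s', V') \<in> K" by (simp add: K_def F_def)
    moreover have "obj (l', s', V') \<le> lp_objective N l V"
      using suml[of N 1] by (simp add: obj_def lp_objective_def V'_def)
    ultimately show ?thesis by blast
  qed
  have KS: "obj p \<in> S" if "p \<in> K" for p
    using that unfolding K_def F_def S_def lp_values_def obj_def by blast
  have "lp_feasible N \<epsilon> 1 1 \<gamma> (\<lambda>_. 0) (\<lambda>k. (1 - \<epsilon>) ^ k) (\<lambda>k. (1 - \<epsilon>) ^ k) 0"
    unfolding lp_feasible_def using eps g by (auto simp: algebra_simps)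
  from reduce[OF this] have "K \<noteq> {}" by blast
  then obtain p where p: "p \<in> K" and pmin: "\<And>q. q \<in> K \<Longrightarrow> obj p \<le> obj q"
    using continuous_attains_inf[OF cK _ cobj] by blast
  have low: "obj p \<le> v" if v: "v \<in> S" for v
  proof -
    obtain l W \<sigma> V where "v = lp_objective N l V" "lp_feasible N \<epsilon> 1 1 \<gamma> l W \<sigma> V"
      using v by (auto simp: S_def lp_values_def)
    then show ?thesis using reduce pmin by (meson order_trans)
  qed
  have "Inf S = obj p"
    using KS[OF p] low by (intro cInf_eq_minimum)
  then have eq: "\<epsilon> * (lp_alpha N \<epsilon> 1 1 \<gamma> - 1) = obj p"
    using eps by (simp add: lp_alpha_def S_def)
  show ?mem using KS[OF p] by (simp add: eq flip: S_def)
  show ?low using low by (simp add: eq flip: S_def)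
qed

end

theory Submission
  imports Defs
begin

text \<open>
  With \<open>\<gamma>lo = \<gamma>hi = 1\<close> the constraints force \<open>W = \<sigma>\<close>. Write \<open>L k\<close> for the tail cost
  \<open>\<Sum>j=k..<N. l j\<close> and \<open>D\<close> for the negated objective \<open>V - L 1\<close>, whose maximum is
  \<open>\<epsilon> (1 - \<alpha>\<^sub>N)\<close>. Besides nonnegativity, the constraints then read
    \<^item> \<open>\<sigma> (k + 1) + L (k + 1) \<le> \<eta> \<sigma> k + L k\<close>, the dynamics,
    \<^item> \<open>L k \<le> \<gamma> (N - k) \<sigma> k\<close> for \<open>k < N\<close>,
    \<^item> \<open>D + L k \<le> \<gamma> (N - k + 1) \<sigma> k\<close> for \<open>1 \<le> k \<le> N\<close>.

  The quantity \<open>Y k = \<sigma> k + L k + D\<close> works as a Lyapunov function: the third constraint says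
  \<open>Y k \<le> (1 + \<gamma> (N - k + 1)) \<sigma> k\<close>, while the dynamics say
  \<open>Y (k + 1) \<le> Y k - \<epsilon> \<sigma> k\<close>, so that \<open>Y\<close> contracts by the factor
  \<open>(\<eta> + \<gamma> (N - k + 1)) / (1 + \<gamma> (N - k + 1))\<close> in each step. At \<open>k = 1\<close> it is at most
  \<open>\<eta> + \<gamma> N + D\<close>, by the dynamics and the second constraint at \<open>k = 0\<close>, and at
  \<open>k = N\<close>, where \<open>L N = 0\<close> and \<open>D \<le> \<gamma> 1 * \<sigma> N\<close>, it satisfies
  \<open>(1 + \<gamma> 1) D \<le> \<gamma> 1 * Y N\<close>. Chaining these gives a linear inequality for \<open>D\<close> whose solution is the
  closed-form bound (\<open>neg_objective_le_bound\<close>).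

  The feasible set grows with \<open>\<gamma>\<close> (\<open>lp_feasible_mono\<close>), so the bound also holds with every
  \<open>\<gamma> k\<close> replaced by \<open>\<gamma>bar\<close>. For that constant sequence it is below \<open>\<epsilon>\<close> exactly when
  \<open>\<gamma>bar (\<eta> + \<gamma>bar)^(N - 1) < \<epsilon> (1 + \<gamma>bar)^(N - 1)\<close>, which is the condition on \<open>N\<close> after taking
  logarithms. Finally, for constant \<open>\<gamma>\<close> all the inequalities used in this argument become
  equalities for a sequence \<open>\<sigma>\<close> that is geometric from index \<open>1\<close> on
  (\<open>constant_bound_attained\<close>), so the bound is sharp.
\<close>

section \<open>The closed-form bound\<close>

definition degradation_bound :: "nat \<Rightarrow> real \<Rightarrow> (nat \<Rightarrow> real) \<Rightarrow> real" where
  "degradation_bound N \<epsilon> \<gamma> =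
     \<gamma> 1 * (\<gamma> N + (1 - \<epsilon>)) * (\<Prod>j=0..<N - 1. (1 - \<epsilon>) + \<gamma> (N - j)) /
     ((\<Prod>j=0..<N. 1 + \<gamma> (N - j)) - \<gamma> 1 * (\<Prod>j=0..<N - 1. (1 - \<epsilon>) + \<gamma> (N - j)))"

lemma degradation_bound_eq_alpha_hat:
  assumes "\<epsilon> \<noteq> 0"
  shows "\<epsilon> * (1 - alpha_hat N \<epsilon> \<gamma>) = degradation_bound N \<epsilon> \<gamma>"
  using assms by (simp add: alpha_hat_def degradation_bound_def Let_def)

lemma degradation_denominator_pos:
  fixes N :: nat and \<epsilon> :: real and \<gamma> :: "nat \<Rightarrow> real"
  assumes N: "N \<ge> 1" and eps: "0 < \<epsilon>" "\<epsilon> < 1" and g: "\<And>k. k \<ge> 1 \<Longrightarrow> 0 \<le> \<gamma> k"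
  shows "0 < (\<Prod>j=0..<N. 1 + \<gamma> (N - j)) - \<gamma> 1 * (\<Prod>j=0..<N - 1. (1 - \<epsilon>) + \<gamma> (N - j))"
proof -
  define P where "P = (\<Prod>j=0..<N - 1. (1 - \<epsilon>) + \<gamma> (N - j))"
  define Q where "Q = (\<Prod>j=0..<N - 1. 1 + \<gamma> (N - j))"
  have gj: "0 \<le> \<gamma> (N - j)" if "j < N - 1" for j
    using that by (intro g) linarith
  have "0 \<le> (1 - \<epsilon>) + \<gamma> (N - j) \<and> (1 - \<epsilon>) + \<gamma> (N - j) \<le> 1 + \<gamma> (N - j)"
    if "j < N - 1" for j
    using gj[OF that] eps by simp
  then have PQ: "P \<le> Q"
    unfolding P_def Q_def by (intro prod_mono) auto
  have "0 < 1 + \<gamma> (N - j)" if "j < N - 1" for j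
    using gj[OF that] by simp
  then have Q: "0 < Q"
    unfolding Q_def by (intro prod_pos) auto
  have "\<gamma> 1 * P \<le> \<gamma> 1 * Q"
    using PQ g[of 1] by (intro mult_left_mono) auto
  moreover have "(\<Prod>j=0..<N. 1 + \<gamma> (N - j)) = Q * (1 + \<gamma> 1)"
    using N prod.atLeast0_lessThan_Suc[of "\<lambda>j. 1 + \<gamma> (N - j)" "N - 1"] by (simp add: Q_def)
  ultimately show ?thesis
    using Q by (simp add: P_def algebra_simps)
qed

lemma degradation_bound_const:
  assumes "N \<ge> 1"
  shows "degradation_bound N \<epsilon> (\<lambda>_. g) =
    g * (g + (1 - \<epsilon>)) * ((1 - \<epsilon>) + g) ^ (N - 1) /
    ((1 + g) ^ N - g * ((1 - \<epsilon>) + g) ^ (N - 1))"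
  by (simp add: degradation_bound_def)

section \<open>Upper bound on the degradation\<close>

lemma lp_feasible_mono:
  assumes f: "lp_feasible N \<epsilon> 1 1 \<gamma> l W \<sigma> V"
    and le: "\<And>k. k \<ge> 1 \<Longrightarrow> \<gamma> k \<le> \<gamma>' k"
  shows "lp_feasible N \<epsilon> 1 1 \<gamma>' l W \<sigma> V"
proof -
  have "\<gamma> (N - k) * \<sigma> k \<le> \<gamma>' (N - k) * \<sigma> k" if "k < N" for k
    using f le[of "N - k"] that by (intro mult_right_mono) (auto simp: lp_feasible_def)
  moreover have "\<gamma> (N - k + 1) * \<sigma> k \<le> \<gamma>' (N - k + 1) * \<sigma> k" if "k \<le> N" for k
    using f le[of "N - k + 1"] that by (intro mult_right_mono) (auto simp: lp_feasible_def)
  ultimately show ?thesis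
    using f unfolding lp_feasible_def by (fastforce intro: order_trans)
qed

text \<open>
  The Lyapunov argument. The contraction estimate is kept in product form, with both sides multiplied
  by the factors \<open>1 + \<gamma> (N - j)\<close>, which yields the numerator and denominator of the bound as they
  stand: the resulting inequality is linear in \<open>D\<close>, and the coefficient collected in front of \<open>D\<close> is
  the positive denominator.
\<close>

lemma neg_objective_le_bound:
  assumes N: "N \<ge> 1" and eps: "0 < \<epsilon>" "\<epsilon> < 1" and g: "\<And>k. k \<ge> 1 \<Longrightarrow> 0 \<le> \<gamma> k"
    and f: "lp_feasible N \<epsilon> 1 1 \<gamma> l W \<sigma> V"
  shows "- lp_objective N l V \<le> degradation_bound N \<epsilon> \<gamma>"
proof -
  define \<eta> where "\<eta> = 1 - \<epsilon>"
  define L where "L = (\<lambda>k. \<Sum>j=k..<N. l j)"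
  define D where "D = V - L 1"
  have s0: "\<sigma> 0 = 1" and W: "\<And>k. k \<le> N \<Longrightarrow> W k = \<sigma> k"
    and dyn0: "\<And>k. k < N \<Longrightarrow> W (k + 1) - W k \<le> - \<epsilon> * \<sigma> k + l k"
    and Vs: "\<And>k. 1 \<le> k \<Longrightarrow> k \<le> N \<Longrightarrow> V \<le> (\<Sum>j=1..<k. l j) + \<gamma> (N - k + 1) * \<sigma> k"
    using f by (auto simp: lp_feasible_def intro!: antisym)
  have "\<forall>k\<in>{0..<N}. L k \<le> \<gamma> (N - k) * \<sigma> k"
    using f by (simp add: lp_feasible_def L_def)
  then have L0: "L 0 \<le> \<gamma> N * \<sigma> 0"
    using N by force
  have dyn: "\<sigma> (Suc k) + L (Suc k) \<le> \<eta> * \<sigma> k + L k" if "k < N" for k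
  proof -
    have "L k = l k + L (Suc k)"
      unfolding L_def using that by (rule sum.atLeast_Suc_lessThan)
    then show ?thesis
      using dyn0[OF that] W[of k] W[of "k + 1"] that by (simp add: \<eta>_def algebra_simps)
  qed
  have DL: "D + L k \<le> \<gamma> (N - k + 1) * \<sigma> k" if "1 \<le> k" "k \<le> N" for k
  proof -
    have "L 1 = (\<Sum>j=1..<k. l j) + L k"
      unfolding L_def using that by (simp add: sum.atLeastLessThan_concat)
    then show ?thesis using Vs[OF that] by (simp add: D_def)
  qed
  have contract: "(\<sigma> (Suc m) + L (Suc m) + D) * (\<Prod>j=0..<m. 1 + \<gamma> (N - j))
      \<le> (\<eta> + \<gamma> N + D) * (\<Prod>j=0..<m. \<eta> + \<gamma> (N - j))" if "m < N" for m
    using that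
  proof (induction m)
    case 0
    then show ?case using dyn[of 0] L0 s0 by simp
  next
    case (Suc m)
    define c where "c = \<gamma> (N - m)"
    define Y where "Y = \<sigma> (Suc m) + L (Suc m) + D"
    define Y' where "Y' = \<sigma> (Suc (Suc m)) + L (Suc (Suc m)) + D"
    have c: "0 \<le> c" using g[of "N - m"] Suc.prems by (simp add: c_def)
    have "N - Suc m + 1 = N - m" using Suc.prems by simp
    then have Ys: "Y \<le> (1 + c) * \<sigma> (Suc m)"
      using DL[of "Suc m"] Suc.prems by (simp add: c_def Y_def algebra_simps)
    have "Y' \<le> Y - \<epsilon> * \<sigma> (Suc m)"
      using dyn[of "Suc m"] Suc.prems by (simp add: Y_def Y'_def \<eta>_def algebra_simps)
    then have "Y' * (1 + c) \<le> (Y - \<epsilon> * \<sigma> (Suc m)) * (1 + c)"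
      using c by (intro mult_right_mono) auto
    also have "\<dots> = Y * (1 + c) - \<epsilon> * ((1 + c) * \<sigma> (Suc m))"
      by (simp add: algebra_simps)
    also have "\<dots> \<le> Y * (1 + c) - \<epsilon> * Y"
      using Ys eps by (intro diff_left_mono mult_left_mono) auto
    also have "\<dots> = Y * (\<eta> + c)"
      by (simp add: \<eta>_def algebra_simps)
    finally have step: "Y' * (1 + c) \<le> Y * (\<eta> + c)" .
    have "0 \<le> 1 + \<gamma> (N - j)" if "j < m" for j
      using g[of "N - j"] that Suc.prems by auto
    then have Q: "0 \<le> (\<Prod>j=0..<m. 1 + \<gamma> (N - j))"
      by (intro prod_nonneg) auto
    have "Y' * ((\<Prod>j=0..<m. 1 + \<gamma> (N - j)) * (1 + c))
        = (Y' * (1 + c)) * (\<Prod>j=0..<m. 1 + \<gamma> (N - j))"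
      by simp
    also have "\<dots> \<le> (Y * (\<eta> + c)) * (\<Prod>j=0..<m. 1 + \<gamma> (N - j))"
      using step Q by (rule mult_right_mono)
    also have "\<dots> = (Y * (\<Prod>j=0..<m. 1 + \<gamma> (N - j))) * (\<eta> + c)"
      by simp
    also have "\<dots> \<le> ((\<eta> + \<gamma> N + D) * (\<Prod>j=0..<m. \<eta> + \<gamma> (N - j))) * (\<eta> + c)"
      using Suc.IH Suc.prems c eps
      by (intro mult_right_mono) (auto simp: Y_def \<eta>_def)
    finally show ?case
      by (simp add: Y'_def c_def mult.assoc)
  qed
  define P where "P = (\<Prod>j=0..<N - 1. \<eta> + \<gamma> (N - j))"
  define Q where "Q = (\<Prod>j=0..<N - 1. 1 + \<gamma> (N - j))"
  have Qfull: "(\<Prod>j=0..<N. 1 + \<gamma> (N - j)) = Q * (1 + \<gamma> 1)"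
    using N prod.atLeast0_lessThan_Suc[of "\<lambda>j. 1 + \<gamma> (N - j)" "N - 1"] by (simp add: Q_def)
  have "0 \<le> 1 + \<gamma> (N - j)" if "j < N - 1" for j
    using g[of "N - j"] that by auto
  then have Q: "0 \<le> Q"
    unfolding Q_def by (intro prod_nonneg) auto
  have "L N = 0" by (simp add: L_def)
  then have last: "(\<sigma> N + D) * Q \<le> (\<eta> + \<gamma> N + D) * P" and DN: "D \<le> \<gamma> 1 * \<sigma> N"
    using contract[of "N - 1"] DL[of N] N by (simp_all add: P_def Q_def)
  have "D * (Q * (1 + \<gamma> 1)) = (D + \<gamma> 1 * D) * Q"
    by (simp add: algebra_simps)
  also have "\<dots> \<le> (\<gamma> 1 * \<sigma> N + \<gamma> 1 * D) * Q"
    using DN Q by (intro mult_right_mono) auto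
  also have "\<dots> = \<gamma> 1 * ((\<sigma> N + D) * Q)"
    by (simp add: algebra_simps)
  also have "\<dots> \<le> \<gamma> 1 * ((\<eta> + \<gamma> N + D) * P)"
    using last g[of 1] by (intro mult_left_mono) auto
  finally have "D * (Q * (1 + \<gamma> 1) - \<gamma> 1 * P) \<le> \<gamma> 1 * (\<gamma> N + \<eta>) * P"
    by (simp add: algebra_simps)
  moreover have "0 < Q * (1 + \<gamma> 1) - \<gamma> 1 * P"
    using degradation_denominator_pos[of N \<epsilon> \<gamma>, OF N eps g]
    unfolding Qfull P_def \<eta>_def .
  ultimately have "D \<le> \<gamma> 1 * (\<gamma> N + \<eta>) * P / (Q * (1 + \<gamma> 1) - \<gamma> 1 * P)"
    by (simp add: pos_le_divide_eq)
  moreover have "- lp_objective N l V = D"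
    by (simp add: lp_objective_def D_def L_def)
  ultimately show ?thesis
    unfolding degradation_bound_def Qfull P_def \<eta>_def by simp
qed

lemma degradation_le_bound:
  assumes N: "N \<ge> 1" and eps: "0 < \<epsilon>" "\<epsilon> < 1"
    and g: "\<And>k. k \<ge> 1 \<Longrightarrow> 0 \<le> \<gamma> k" and le: "\<And>k. k \<ge> 1 \<Longrightarrow> \<gamma> k \<le> \<gamma>' k"
  shows "\<epsilon> * (1 - lp_alpha N \<epsilon> 1 1 \<gamma>) \<le> degradation_bound N \<epsilon> \<gamma>'"
proof -
  obtain l W \<sigma> V where opt: "\<epsilon> * (lp_alpha N \<epsilon> 1 1 \<gamma> - 1) = lp_objective N l V"
    and f: "lp_feasible N \<epsilon> 1 1 \<gamma> l W \<sigma> V"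
    using lp_alpha_minimum(1)[of N \<epsilon> \<gamma>, OF N eps g] by (auto simp: lp_values_def)
  have "- lp_objective N l V \<le> degradation_bound N \<epsilon> \<gamma>'"
    using N eps order_trans[OF g le] lp_feasible_mono[OF f le]
    by (rule neg_objective_le_bound)
  then show ?thesis by (simp add: algebra_simps flip: opt)
qed

section \<open>The horizon threshold\<close>

text \<open>
  Since \<open>g (g + \<eta>) + \<epsilon> g = g (1 + g)\<close>, clearing the denominator in \<open>degradation_bound < \<epsilon>\<close> leaves a
  common factor \<open>1 + g\<close>; cancelling it turns the exponent \<open>N\<close> into \<open>N - 1\<close>, which is the origin of
  the summand \<open>1\<close> in the threshold.
\<close>

lemma degradation_bound_const_less:
  assumes N: "N \<ge> 1" and eps: "0 < \<epsilon>" "\<epsilon> < 1" and g: "0 \<le> g"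
    and large: "ereal (real N) > N_lower \<epsilon> g"
  shows "degradation_bound N \<epsilon> (\<lambda>_. g) < \<epsilon>"
proof -
  define p where "p = ((1 - \<epsilon>) + g) ^ (N - 1)"
  define q where "q = (1 + g) ^ (N - 1)"
  have qN: "(1 + g) ^ N = (1 + g) * q"
    using N by (cases N) (auto simp: q_def)
  have key: "g * p < \<epsilon> * q"
  proof (cases "g = 0")
    case True
    then show ?thesis using eps by (simp add: q_def)
  next
    case False
    then have g: "0 < g" using g by simp
    define d where "d = ln (1 + g) - ln (g + (1 - \<epsilon>))"
    have d: "0 < d"
      using eps g by (simp add: d_def)
    have "(ln g - ln \<epsilon>) / d < real N - 1"
      using large g by (simp add: N_lower_def Let_def d_def)
    then have "ln g - ln \<epsilon> < real (N - 1) * d"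
      using d N by (simp add: pos_divide_less_eq of_nat_diff)
    moreover have p: "0 < p" and q: "0 < q"
      using eps g by (auto simp: p_def q_def)
    moreover have "ln p = real (N - 1) * ln (g + (1 - \<epsilon>))"
      using eps g by (simp add: p_def ln_realpow add.commute)
    moreover have "ln q = real (N - 1) * ln (1 + g)"
      using g by (simp add: q_def ln_realpow)
    ultimately have "ln (g * p) < ln (\<epsilon> * q)"
      using g eps by (simp add: ln_mult_pos d_def right_diff_distrib)
    then show ?thesis
      using p q g eps by simp
  qed
  have "(1 + g) * (g * p) < (1 + g) * (\<epsilon> * q)"
    using key g by (intro mult_strict_left_mono) auto
  then have "g * (g + (1 - \<epsilon>)) * p < \<epsilon> * ((1 + g) * q - g * p)"
    by (simp add: algebra_simps)
  moreover have "0 < (1 + g) * q - g * p"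
    using degradation_denominator_pos[of N \<epsilon> "\<lambda>_. g", OF N eps] g
    by (simp add: p_def qN)
  ultimately show ?thesis
    unfolding degradation_bound_const[OF N] qN p_def[symmetric]
    by (simp add: pos_divide_less_eq)
qed

section \<open>Sharpness for constant bounds\<close>

text \<open>
  Equality throughout the Lyapunov argument dictates the optimal solution: with
  \<open>D = degradation_bound N \<epsilon> (\<lambda>_. g)\<close> and the contraction factor \<open>r\<close>, the states are
  \<open>\<sigma> (k + 1) = s * r^k\<close> and the tail costs are \<open>L 0 = g\<close>, \<open>L k = g * \<sigma> k - D\<close>. The value
  of \<open>s\<close> comes from equality in the first step of the dynamics, and the formula for \<open>D\<close> is what makes
  the final tail cost \<open>L N = g * \<sigma> N - D\<close> vanish.
\<close>

lemma constant_bound_attained: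
  assumes N: "N \<ge> 1" and eps: "0 < \<epsilon>" "\<epsilon> < 1" and g: "0 \<le> g"
  shows "- degradation_bound N \<epsilon> (\<lambda>_. g) \<in> lp_values N \<epsilon> 1 1 (\<lambda>_. g)"
proof -
  define D where "D = degradation_bound N \<epsilon> (\<lambda>_. g)"
  define \<eta> where "\<eta> = 1 - \<epsilon>"
  define r where "r = (\<eta> + g) / (1 + g)"
  define s where "s = (\<eta> + g + D) / (1 + g)"
  define \<sigma> where "\<sigma> = (\<lambda>k. case k of 0 \<Rightarrow> 1 | Suc m \<Rightarrow> s * r ^ m)"
  define L where "L = (\<lambda>k. if k = 0 then g else g * \<sigma> k - D)"
  define l where "l = (\<lambda>k. L k - L (Suc k))"
  have den: "0 < (1 + g) ^ N - g * (\<eta> + g) ^ (N - 1)"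
    using degradation_denominator_pos[of N \<epsilon> "\<lambda>_. g", OF N eps] g by (simp add: \<eta>_def)
  have D_eq: "D = g * (g + \<eta>) * (\<eta> + g) ^ (N - 1) / ((1 + g) ^ N - g * (\<eta> + g) ^ (N - 1))"
    by (simp add: D_def degradation_bound_const[OF N] \<eta>_def)
  have D0: "0 \<le> D"
    unfolding D_eq using den g eps
    by (intro divide_nonneg_pos mult_nonneg_nonneg zero_le_power) (auto simp: \<eta>_def)
  have r: "0 \<le> r" "r \<le> 1" and s: "0 \<le> s"
    using g eps D0 by (auto simp: r_def s_def \<eta>_def)
  have sig0: "\<sigma> 0 = 1" and sig_nonneg: "0 \<le> \<sigma> k" for k
    using r s by (auto simp: \<sigma>_def split: nat.split)
  have sig1: "(1 + g) * \<sigma> (Suc 0) = \<eta> + g + D"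
    using g by (simp add: \<sigma>_def s_def)
  have sig_Suc: "\<sigma> (Suc k) = r * \<sigma> k" if "1 \<le> k" for k
    using that by (cases k) (auto simp: \<sigma>_def)
  have sig_step: "(1 + g) * \<sigma> (Suc k) = (\<eta> + g) * \<sigma> k" if "1 \<le> k" for k
    using g by (simp add: sig_Suc[OF that] r_def)
  have LN: "L N = 0"
  proof -
    have "D * ((1 + g) ^ N - g * (\<eta> + g) ^ (N - 1)) = g * (g + \<eta>) * (\<eta> + g) ^ (N - 1)"
      unfolding D_eq using den by simp
    then have "D * (1 + g) ^ N = g * (\<eta> + g + D) * (\<eta> + g) ^ (N - 1)"
      by (simp add: algebra_simps)
    moreover have "(1 + g) ^ N = (1 + g) * (1 + g) ^ (N - 1)"
      using N by (cases N) auto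
    moreover have "\<sigma> N = s * r ^ (N - 1)"
      using N by (cases N) (auto simp: \<sigma>_def)
    then have "\<sigma> N * ((1 + g) * (1 + g) ^ (N - 1)) = (\<eta> + g + D) * (\<eta> + g) ^ (N - 1)"
      using g by (simp add: s_def r_def power_divide)
    ultimately have "(g * \<sigma> N) * (1 + g) ^ N = D * (1 + g) ^ N"
      by (simp add: mult.assoc)
    then have "g * \<sigma> N = D" using g by simp
    then show ?thesis using N by (simp add: L_def)
  qed
  have sum_l: "(\<Sum>j=a..<b. l j) = L a - L b" if "a \<le> b" for a b
    using sum_Suc_diff'[OF that, of "\<lambda>k. - L k"] by (simp add: l_def)
  have l_nonneg: "0 \<le> l k" for k
  proof (cases "k = 0")
    case True
    have "(1 + g) * l 0 = g * (1 + g) - g * ((1 + g) * \<sigma> (Suc 0)) + (1 + g) * D"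
      by (simp add: l_def L_def algebra_simps)
    also have "\<dots> = g * \<epsilon> + D"
      unfolding sig1 by (simp add: \<eta>_def algebra_simps)
    finally have "0 \<le> (1 + g) * l 0" using g eps D0 by simp
    then show ?thesis using g True by (simp add: zero_le_mult_iff)
  next
    case False
    have "r * \<sigma> k \<le> 1 * \<sigma> k"
      using r sig_nonneg by (intro mult_right_mono)
    then have "g * \<sigma> (Suc k) \<le> g * \<sigma> k"
      using g False by (intro mult_left_mono) (auto simp: sig_Suc)
    then show ?thesis using False by (simp add: l_def L_def)
  qed
  have dyn: "\<sigma> (Suc k) - \<sigma> k = - \<epsilon> * \<sigma> k + l k" for k
  proof (cases "k = 0")
    case True
    then show ?thesis
      using sig1 sig0 by (simp add: l_def L_def \<eta>_def algebra_simps)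
  next
    case False
    then show ?thesis
      using sig_step[of k] by (simp add: l_def L_def \<eta>_def algebra_simps)
  qed
  have tail: "L k \<le> g * \<sigma> k" for k
    using D0 by (simp add: L_def sig0)
  have "lp_feasible N \<epsilon> 1 1 (\<lambda>_. g) l \<sigma> \<sigma> (L 1 + D)"
    unfolding lp_feasible_def
    using sig0 sig_nonneg l_nonneg dyn tail LN by (auto simp: sum_l) (auto simp: L_def)
  moreover have "lp_objective N l (L 1 + D) = - D"
    using N by (simp add: lp_objective_def sum_l LN)
  ultimately show ?thesis
    unfolding lp_values_def D_def[symmetric] by force
qed

lemma lp_values_const_cong:
  assumes "\<forall>k\<ge>1. \<gamma> k = g"
  shows "lp_values N \<epsilon> 1 1 \<gamma> = lp_values N \<epsilon> 1 1 (\<lambda>_. g)"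
  using lp_feasible_mono[of N \<epsilon> \<gamma> _ _ _ _ "\<lambda>_. g"] lp_feasible_mono[of N \<epsilon> "\<lambda>_. g" _ _ _ _ \<gamma>] assms
  unfolding lp_values_def by fastforce

lemma degradation_bound_const_cong:
  assumes "N \<ge> 1" "\<forall>k\<ge>1. \<gamma> k = g"
  shows "degradation_bound N \<epsilon> \<gamma> = degradation_bound N \<epsilon> (\<lambda>_. g)"
  using assms by (simp add: degradation_bound_def)

section \<open>The performance estimate\<close>

theorem theorem3:
  fixes N :: nat and \<epsilon> \<gamma>bar :: real and \<gamma> :: "nat \<Rightarrow> real"
  assumes "N \<ge> 1"
    and "0 < \<epsilon>" and "\<epsilon> < 1"
    and "\<gamma>bar \<ge> 0"
    and "\<forall>k\<ge>1. 0 \<le> \<gamma> k \<and> \<gamma> k \<le> \<gamma>bar"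
  shows "\<epsilon> * (1 - lp_alpha N \<epsilon> 1 1 \<gamma>) \<le> \<epsilon> * (1 - alpha_hat N \<epsilon> \<gamma>) \<and>
    (ereal (real N) > N_lower \<epsilon> \<gamma>bar \<longrightarrow> lp_alpha N \<epsilon> 1 1 \<gamma> > 0) \<and>
    ((\<forall>k\<ge>1. \<gamma> k = \<gamma>bar) \<longrightarrow> lp_alpha N \<epsilon> 1 1 \<gamma> = alpha_hat N \<epsilon> \<gamma>)"
proof (intro conjI impI)
  have g: "\<And>k. k \<ge> 1 \<Longrightarrow> 0 \<le> \<gamma> k" and gbar: "\<And>k. k \<ge> 1 \<Longrightarrow> \<gamma> k \<le> \<gamma>bar"
    using assms by auto
  have hat: "\<epsilon> * (1 - alpha_hat N \<epsilon> \<gamma>) = degradation_bound N \<epsilon> \<gamma>"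
    using assms by (simp add: degradation_bound_eq_alpha_hat)
  show upper: "\<epsilon> * (1 - lp_alpha N \<epsilon> 1 1 \<gamma>) \<le> \<epsilon> * (1 - alpha_hat N \<epsilon> \<gamma>)"
    unfolding hat using assms(1-3) g by (rule degradation_le_bound) simp_all
  show "lp_alpha N \<epsilon> 1 1 \<gamma> > 0" if "ereal (real N) > N_lower \<epsilon> \<gamma>bar"
  proof -
    have "\<epsilon> * (1 - lp_alpha N \<epsilon> 1 1 \<gamma>) \<le> degradation_bound N \<epsilon> (\<lambda>_. \<gamma>bar)"
      using assms(1-3) g gbar by (rule degradation_le_bound)
    also have "\<dots> < \<epsilon>"
      using assms(1-4) that by (rule degradation_bound_const_less)
    finally have "0 < \<epsilon> * lp_alpha N \<epsilon> 1 1 \<gamma>"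
      by (simp add: algebra_simps)
    then show ?thesis using assms by (simp add: zero_less_mult_iff)
  qed
  show "lp_alpha N \<epsilon> 1 1 \<gamma> = alpha_hat N \<epsilon> \<gamma>" if const: "\<forall>k\<ge>1. \<gamma> k = \<gamma>bar"
  proof -
    have "- degradation_bound N \<epsilon> \<gamma> \<in> lp_values N \<epsilon> 1 1 \<gamma>"
      using constant_bound_attained[OF assms(1-4)]
      by (simp add: lp_values_const_cong[OF const] degradation_bound_const_cong[OF assms(1) const])
    then have "\<epsilon> * (lp_alpha N \<epsilon> 1 1 \<gamma> - 1) \<le> - degradation_bound N \<epsilon> \<gamma>"
      using lp_alpha_minimum(2)[of N \<epsilon> \<gamma>, OF assms(1-3) g] by blast
    then have "\<epsilon> * (1 - alpha_hat N \<epsilon> \<gamma>) \<le> \<epsilon> * (1 - lp_alpha N \<epsilon> 1 1 \<gamma>)"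
      unfolding hat by (simp add: algebra_simps)
    with upper have "\<epsilon> * (1 - lp_alpha N \<epsilon> 1 1 \<gamma>) = \<epsilon> * (1 - alpha_hat N \<epsilon> \<gamma>)"
      by simp
    then show ?thesis using assms by simp
  qed
qed

end
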